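(* Let $k$ be an algebraically closed field of characteristic $p>0$, let $k[[\underline{x}]]=k[[x_1,\dots,x_n]]$ with maximal ideal $\mathfrak{m}=\langle x_1,\dots,x_n\rangle$, let $f\in\mathfrak{m}^2$, and assume that $\tau(f)<\infty$. Then: (1) If $\mu(f)<\infty$, then $\operatorname{fpt}(f)\geq\frac{1}{\tau(f)}-\frac{1}{\mu(f)}$. (2) If $\mu(f)=\infty$, then $\operatorname{fpt}(f)\geq\frac{1}{\tau(f)}$.
   Context: For $f\in\mathfrak{m}$, the Jacobian ideal is $\operatorname{Jac}(f)=\langle\partial_1(f),\dots,\partial_n(f)\rangle$ (formal partial derivatives). The Milnor and Tjurina numbers are $\mu(f)=\dim_k\big(k[[\underline{x}]]/\operatorname{Jac}(f)\big)$ and $\tau(f)=\dim_k\big(k[[\underline{x}]]/(\operatorname{Jac}(f)+\langle f\rangle)\big)$, possibly infinite. For an ideal $J$ and $e\ge 0$, $J^{[p^e]}$ denotes the ideal generated by the $p^e$-th powers of the elements of $J$. For $f\in\mathfrak{m}$, let $\nu_e(f)$ be the largest integer $N\geq 0$ such that $f^N\notin\mathfrak{m}^{[p^e]}$; the $F$-pure threshold of $f$ is $\operatorname{fpt}(f)=\lim_{e\to\infty}\nu_e(f)/p^e$ (the limit exists). *)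

theory Defs
  imports
    Complex_Main
    "HOL-Library.Extended_Nat"
    "HOL-Algebra.QuotRing"
    "HOL-Algebra.Ideal_Product"
    "HOL-Algebra.Embedded_Algebras"
    "HOL-Algebra.Algebraic_Closure_Type"
begin

section \<open>Formal power series in finitely many variables\<close>

text \<open>
  The type \<open>('n, 'k) mfps\<close> is the ring \<open>k[[x\<^sub>1, \<dots>, x\<^sub>n]]\<close>, where \<open>n = CARD('n)\<close> and the variables
  are indexed by the finite type \<open>'n\<close>. A series is its family of coefficients, indexed by the
  exponent vectors \<open>'n \<Rightarrow> nat\<close>; \<open>\<le>\<close> and \<open>-\<close> on exponent vectors are the pointwise operations.
\<close>

typedef (overloaded) ('n, 'k) mfps = "UNIV :: (('n::finite \<Rightarrow> nat) \<Rightarrow> 'k) set"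
  morphisms mfps_coeff Abs_mfps
  by simp

setup_lifting type_definition_mfps

lemma mfps_eqI: "(\<And>a. mfps_coeff f a = mfps_coeff g a) \<Longrightarrow> f = g"
  by transfer auto

lemma finite_exponents_le: "finite {..a :: 'n::finite \<Rightarrow> nat}"
proof -
  have "{..a} \<subseteq> (\<Pi>\<^sub>E i\<in>UNIV. {..a i})"
    by (auto simp: le_fun_def)
  moreover have "finite (\<Pi>\<^sub>E i\<in>(UNIV :: 'n set). {..a i})"
    by (rule finite_PiE) auto
  ultimately show ?thesis
    by (rule finite_subset)
qed

instantiation mfps :: (finite, comm_ring_1) comm_ring_1
begin

lift_definition zero_mfps :: "('a, 'b) mfps" is "\<lambda>_. 0" .

lift_definition one_mfps :: "('a, 'b) mfps" is "\<lambda>a. if a = (\<lambda>_. 0) then 1 else 0" .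

lift_definition plus_mfps :: "('a, 'b) mfps \<Rightarrow> ('a, 'b) mfps \<Rightarrow> ('a, 'b) mfps"
  is "\<lambda>f g a. f a + g a" .

lift_definition uminus_mfps :: "('a, 'b) mfps \<Rightarrow> ('a, 'b) mfps"
  is "\<lambda>f a. - f a" .

lift_definition minus_mfps :: "('a, 'b) mfps \<Rightarrow> ('a, 'b) mfps \<Rightarrow> ('a, 'b) mfps"
  is "\<lambda>f g a. f a - g a" .

lift_definition times_mfps :: "('a, 'b) mfps \<Rightarrow> ('a, 'b) mfps \<Rightarrow> ('a, 'b) mfps"
  is "\<lambda>f g a. \<Sum>b\<in>{..a}. f b * g (a - b)" .

instance
proof
  fix f g h :: "('a, 'b) mfps"
  show "f * g * h = f * (g * h)"
  proof (transfer, rule ext)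
    fix f g h :: "('a \<Rightarrow> nat) \<Rightarrow> 'b" and a :: "'a \<Rightarrow> nat"
    have "(\<Sum>b\<in>{..a}. (\<Sum>c\<in>{..b}. f c * g (b - c)) * h (a - b)) =
          (\<Sum>(b, c)\<in>Sigma {..a} (\<lambda>b. {..b}). f c * g (b - c) * h (a - b))"
      by (simp add: sum_distrib_right sum.Sigma finite_exponents_le)
    also have "\<dots> = (\<Sum>(c, d)\<in>Sigma {..a} (\<lambda>c. {..a - c}). f c * (g d * h (a - c - d)))"
    proof (rule sum.reindex_bij_witness
        [where j = "\<lambda>(b, c). (c, b - c)" and i = "\<lambda>(c, d). (\<lambda>i. c i + d i, c)"], goal_cases)
      case (1 x)
      then show ?case by (auto simp: le_fun_def fun_eq_iff)
    next
      case (2 x)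
      then show ?case
        by (auto simp: le_fun_def) (meson order_trans, meson diff_le_mono)
    next
      case (3 x)
      then show ?case by (auto simp: le_fun_def fun_eq_iff)
    next
      case (4 x)
      then show ?case
        by (auto simp: le_fun_def) (metis le_diff_conv2 add.commute)
    next
      case (5 x)
      then obtain b c where x: "x = (b, c)" "c \<le> b" "b \<le> a" by auto
      then have "a - c - (b - c) = a - b" by (auto simp: le_fun_def fun_eq_iff)
      with x show ?case by (simp add: mult.assoc)
    qed
    also have "\<dots> = (\<Sum>c\<in>{..a}. f c * (\<Sum>d\<in>{..a - c}. g d * h (a - c - d)))"
      by (simp add: sum_distrib_left sum.Sigma finite_exponents_le)
    finally show "(\<Sum>b\<in>{..a}. (\<Sum>c\<in>{..b}. f c * g (b - c)) * h (a - b)) =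
        (\<Sum>c\<in>{..a}. f c * (\<Sum>d\<in>{..a - c}. g d * h (a - c - d)))" .
  qed
  show "f * g = g * f"
  proof (transfer, rule ext)
    fix f g :: "('a \<Rightarrow> nat) \<Rightarrow> 'b" and a :: "'a \<Rightarrow> nat"
    have 1: "a - (a - b) = b" if "b \<le> a" for b
      using that by (simp add: le_fun_def fun_eq_iff)
    have 2: "a - b \<le> a" for b
      by (simp add: le_fun_def)
    show "(\<Sum>b\<in>{..a}. f b * g (a - b)) = (\<Sum>b\<in>{..a}. g b * f (a - b))"
      by (rule sum.reindex_bij_witness[where i = "\<lambda>b. a - b" and j = "\<lambda>b. a - b"])
         (auto simp: 1 2 mult.commute)
  qed
  show "1 * f = f"
  proof (transfer, rule ext)
    fix f :: "('a \<Rightarrow> nat) \<Rightarrow> 'b" and a :: "'a \<Rightarrow> nat"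
    have "(\<Sum>b\<in>{..a}. (if b = (\<lambda>_. 0) then 1 else 0) * f (a - b)) =
          (\<Sum>b\<in>{..a}. if b = (\<lambda>_. 0) then f (a - (\<lambda>_. 0)) else 0)"
      by (rule sum.cong) auto
    also have "\<dots> = f a"
      by (simp add: finite_exponents_le le_fun_def fun_diff_def)
    finally show "(\<Sum>b\<in>{..a}. (if b = (\<lambda>_. 0) then 1 else 0) * f (a - b)) = f a" .
  qed
  show "(f + g) * h = f * h + g * h"
    by transfer (simp add: distrib_right sum.distrib)
  show "f + g + h = f + (g + h)" by transfer (simp add: add.assoc)
  show "f + g = g + f" by transfer (simp add: add.commute)
  show "0 + f = f" by transfer simp
  show "- f + f = 0" by transfer simp
  show "f - g = f + - g" by transfer simp
  show "(0 :: ('a, 'b) mfps) \<noteq> 1" by transfer (auto simp: fun_eq_iff)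
qed

end

lift_definition mfps_const :: "'k \<Rightarrow> ('n::finite, 'k::zero) mfps"
  is "\<lambda>c a. if a = (\<lambda>_. 0) then c else 0" .

lift_definition mfps_var :: "'n \<Rightarrow> ('n::finite, 'k::zero_neq_one) mfps"
  is "\<lambda>i a. if a = (\<lambda>_. 0)(i := 1) then 1 else 0" .

lift_definition mfps_pderiv :: "'n \<Rightarrow> ('n::finite, 'k::semiring_1) mfps \<Rightarrow> ('n, 'k) mfps"
  is "\<lambda>i f a. of_nat (Suc (a i)) * f (a(i := Suc (a i)))" .

abbreviation mfps_ring :: "('n::finite, 'k::comm_ring_1) mfps ring"
  where "mfps_ring \<equiv> ring_of_type_algebra"


section \<open>Ideals of the power series ring\<close>

definition maximal_ideal :: "('n::finite, 'k::comm_ring_1) mfps set"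
  where "maximal_ideal = Idl\<^bsub>mfps_ring\<^esub> (range mfps_var)"

definition jacobian_ideal :: "('n::finite, 'k::comm_ring_1) mfps \<Rightarrow> ('n, 'k) mfps set"
  where "jacobian_ideal f = Idl\<^bsub>mfps_ring\<^esub> (range (\<lambda>i. mfps_pderiv i f))"

definition tjurina_ideal :: "('n::finite, 'k::comm_ring_1) mfps \<Rightarrow> ('n, 'k) mfps set"
  where "tjurina_ideal f = jacobian_ideal f <+>\<^bsub>mfps_ring\<^esub> Idl\<^bsub>mfps_ring\<^esub> {f}"

definition frobenius_power ::
    "('n::finite, 'k::comm_ring_1) mfps set \<Rightarrow> nat \<Rightarrow> ('n, 'k) mfps set"
  where "frobenius_power J q = Idl\<^bsub>mfps_ring\<^esub> ((\<lambda>g. g ^ q) ` J)"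


section \<open>Milnor and Tjurina numbers\<close>

text \<open>
  \<open>quotient_dim J\<close> is the dimension of the quotient ring by \<open>J\<close> as a vector space over \<open>k\<close>, the
  scalars being the residue classes of the constant power series.
\<close>

definition quotient_dim :: "('n::finite, 'k::field) mfps set \<Rightarrow> enat"
  where "quotient_dim J =
    (let Q = mfps_ring Quot J;
         K = range (\<lambda>c. J +>\<^bsub>mfps_ring\<^esub> mfps_const c)
     in if ring.finite_dimension Q K (carrier Q)
        then enat (ring.dim Q K (carrier Q)) else \<infinity>)"

definition milnor_number :: "('n::finite, 'k::field) mfps \<Rightarrow> enat"
  where "milnor_number f = quotient_dim (jacobian_ideal f)"

definition tjurina_number :: "('n::finite, 'k::field) mfps \<Rightarrow> enat"
  where "tjurina_number f = quotient_dim (tjurina_ideal f)"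


section \<open>The F-pure threshold\<close>

text \<open>
  These are meant for \<open>f\<close> in the maximal ideal and \<open>p = CHAR('k) > 0\<close>: then the set of \<open>N\<close> in
  \<open>frob_nu\<close> contains \<open>0\<close> and is bounded, so that \<open>GREATEST\<close> is its maximum.
\<close>

definition frob_nu :: "('n::finite, 'k::field) mfps \<Rightarrow> nat \<Rightarrow> nat"
  where "frob_nu f e = (GREATEST N. f ^ N \<notin> frobenius_power maximal_ideal (CHAR('k) ^ e))"

definition fpt :: "('n::finite, 'k::field) mfps \<Rightarrow> real"
  where "fpt f = lim (\<lambda>e. real (frob_nu f e) / real (CHAR('k) ^ e))"

end

theory Submission
  imports Defs
begin

text \<open>
  Let \<open>d\<close> be the order of \<open>f\<close>, so that \<open>Jac(f) + \<langle>f\<rangle>\<close> is contained in \<open>\<mm>\<^sup>d\<^sup>-\<^sup>1\<close>. If \<open>f\<close> lies in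
  \<open>Jac(f)\<close>, then \<open>\<tau>(f) = \<mu>(f)\<close> and the bound in (1) is \<open>0\<close>, while (2) is void. Otherwise
  \<open>Jac(f) + \<langle>f\<rangle>\<close> is different from \<open>\<mm>\<^sup>d\<^sup>-\<^sup>1\<close> by Nakayama's lemma, so that the chain of the powers of
  \<open>\<mm>\<close> down to \<open>\<mm>\<^sup>d\<^sup>-\<^sup>1\<close> gives \<open>\<tau>(f) \<ge> d\<close>; and \<open>fpt(f) \<ge> 1/d\<close>, because \<open>f\<^sup>N\<close> has order \<open>N d\<close> and so
  cannot lie in \<open>\<mm>\<^sup>[\<^sup>q\<^sup>]\<close> when \<open>N d < q\<close>.
\<close>

section \<open>Coefficients and monomials\<close>

lemma mfps_coeff_zero [simp]: "mfps_coeff 0 a = 0"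
  by transfer simp

lemma mfps_coeff_one: "mfps_coeff 1 a = (if a = (\<lambda>_. 0) then 1 else 0)"
  by transfer simp

lemma mfps_coeff_add [simp]: "mfps_coeff (f + g) a = mfps_coeff f a + mfps_coeff g a"
  by transfer simp

lemma mfps_coeff_diff [simp]: "mfps_coeff (f - g) a = mfps_coeff f a - mfps_coeff g a"
  by transfer simp

lemma mfps_coeff_mult: "mfps_coeff (f * g) a = (\<Sum>b\<in>{..a}. mfps_coeff f b * mfps_coeff g (a - b))"
  by transfer simp

lemma mfps_coeff_sum [simp]: "mfps_coeff (sum f A) a = (\<Sum>i\<in>A. mfps_coeff (f i) a)"
  by (induction A rule: infinite_finite_induct) auto

lemma mfps_coeff_const: "mfps_coeff (mfps_const c) a = (if a = (\<lambda>_. 0) then c else 0)"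
  by transfer simp

lemma mfps_coeff_pderiv:
  "mfps_coeff (mfps_pderiv i f) a = of_nat (Suc (a i)) * mfps_coeff f (a(i := Suc (a i)))"
  by transfer simp

section \<open>Monomials and their products\<close>

lift_definition mfps_monom :: "('n \<Rightarrow> nat) \<Rightarrow> ('n::finite, 'k::zero_neq_one) mfps"
  is "\<lambda>a b. if b = a then 1 else 0" .

lemma mfps_coeff_monom: "mfps_coeff (mfps_monom a) b = (if b = a then 1 else 0)"
  by transfer simp

lemma mfps_coeff_monom_mult:
  fixes h :: "('n::finite, 'k::comm_ring_1) mfps"
  shows "mfps_coeff (mfps_monom a * h) b = (if a \<le> b then mfps_coeff h (b - a) else 0)"
proof -
  have "mfps_coeff (mfps_monom a * h) b =
      (\<Sum>c\<in>{..b}. if c = a then mfps_coeff h (b - a) else 0)"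
    unfolding mfps_coeff_mult by (rule sum.cong) (auto simp: mfps_coeff_monom)
  then show ?thesis
    by (simp add: finite_exponents_le)
qed

lemma mfps_monom_mult:
  "mfps_monom a * mfps_monom b = (mfps_monom (\<lambda>i. a i + b i) :: ('n::finite, 'k::comm_ring_1) mfps)"
proof (rule mfps_eqI)
  fix c :: "'n \<Rightarrow> nat"
  have "a \<le> c \<and> c - a = b \<longleftrightarrow> c = (\<lambda>i. a i + b i)"
    by (auto simp: le_fun_def fun_eq_iff) (metis le_add_diff_inverse)
  then show "mfps_coeff (mfps_monom a * mfps_monom b) c =
      mfps_coeff (mfps_monom (\<lambda>i. a i + b i) :: ('n, 'k) mfps) c"
    by (auto simp: mfps_coeff_monom_mult mfps_coeff_monom)
qed

lemma mfps_monom_zero: "mfps_monom (\<lambda>_. 0) = 1"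
  by (rule mfps_eqI) (simp add: mfps_coeff_monom mfps_coeff_one)

lemma mfps_monom_power:
  "mfps_monom a ^ n = (mfps_monom (\<lambda>i. n * a i) :: ('n::finite, 'k::comm_ring_1) mfps)"
  by (induction n) (simp_all add: mfps_monom_zero mfps_monom_mult)

lemma mfps_var_eq_monom: "mfps_var i = mfps_monom ((\<lambda>_. 0)(i := 1))"
  by (rule mfps_eqI) (transfer, simp)

lemma mfps_var_power:
  "mfps_var i ^ n = (mfps_monom ((\<lambda>_. 0)(i := n)) :: ('n::finite, 'k::comm_ring_1) mfps)"
proof -
  have "(\<lambda>j. n * ((\<lambda>_. 0)(i := 1)) j) = (\<lambda>_. 0)(i := n)"
    by auto
  then show ?thesis
    by (simp add: mfps_var_eq_monom mfps_monom_power)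
qed

lemma mfps_coeff_var_power_mult:
  fixes h :: "('n::finite, 'k::comm_ring_1) mfps"
  shows "mfps_coeff (mfps_var i ^ n * h) a = (if n \<le> a i then mfps_coeff h (a(i := a i - n)) else 0)"
proof -
  have "(\<lambda>_. 0)(i := n) \<le> a \<longleftrightarrow> n \<le> a i"
    by (auto simp: le_fun_def)
  moreover have "a - (\<lambda>_. 0)(i := n) = a(i := a i - n)"
    by auto
  ultimately show ?thesis
    by (simp add: mfps_var_power mfps_coeff_monom_mult)
qed

section \<open>Constant series and the characteristic\<close>

lemma mfps_const_add: "mfps_const (a + b) = mfps_const a + mfps_const b"
  by (rule mfps_eqI) (simp add: mfps_coeff_const)

lemma mfps_coeff_const_mult [simp]:
  fixes h :: "('n::finite, 'k::comm_ring_1) mfps"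
  shows "mfps_coeff (mfps_const c * h) a = c * mfps_coeff h a"
proof -
  have "mfps_coeff (mfps_const c * h) a = (\<Sum>b\<in>{..a}. if b = (\<lambda>_. 0) then c * mfps_coeff h a else 0)"
    unfolding mfps_coeff_mult by (rule sum.cong) (auto simp: mfps_coeff_const fun_diff_def)
  then show ?thesis
    by (simp add: finite_exponents_le le_fun_def)
qed

lemma mfps_const_mult: "mfps_const (a * b) = mfps_const a * (mfps_const b :: ('n::finite, 'k::comm_ring_1) mfps)"
  by (rule mfps_eqI) (simp add: mfps_coeff_const)

lemma mfps_const_one: "mfps_const 1 = 1"
  by (rule mfps_eqI) (simp add: mfps_coeff_const mfps_coeff_one)

lemma mfps_of_nat: "(of_nat n :: ('n::finite, 'k::comm_ring_1) mfps) = mfps_const (of_nat n)"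
proof (induction n)
  case 0
  show ?case by (rule mfps_eqI) (simp add: mfps_coeff_const)
qed (simp add: mfps_const_add mfps_const_one)

lemma CHAR_mfps: "CHAR(('n::finite, 'k::comm_ring_1) mfps) = CHAR('k)"
proof (rule CHAR_eqI)
  show "of_nat CHAR('k) = (0 :: ('n, 'k) mfps)"
    by (rule mfps_eqI) (simp add: mfps_of_nat mfps_coeff_const)
next
  fix n assume "of_nat n = (0 :: ('n, 'k) mfps)"
  then have "mfps_coeff (of_nat n :: ('n, 'k) mfps) (\<lambda>_. 0) = 0"
    by simp
  then show "CHAR('k) dvd n"
    by (simp add: mfps_of_nat mfps_coeff_const of_nat_eq_0_iff_char_dvd)
qed

lemma prime_CHAR_mfps:
  assumes "CHAR('k::field) > 0"
  shows "prime CHAR(('n::finite, 'k) mfps)"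
  using prime_CHAR_semidom[OF assms] by (simp add: CHAR_mfps)

text \<open>Each exponent of \<open>h\<close> is assigned to one variable whose entry is at least
  \<open>q\<close>; \<open>g i\<close> collects the terms assigned to \<open>i\<close>, divided by
  the \<open>q\<close>-th power of that variable. The second conclusion allows orders to be tracked
  through the division.\<close>

lemma mfps_splitE:
  fixes h :: "('n::finite, 'k::comm_ring_1) mfps"
  assumes "\<And>a. mfps_coeff h a \<noteq> 0 \<Longrightarrow> \<exists>i. q \<le> a i"
  obtains g where "h = (\<Sum>i\<in>UNIV. mfps_var i ^ q * g i)"
    and "\<And>i b. mfps_coeff (g i) b \<noteq> 0 \<Longrightarrow> mfps_coeff h (b(i := b i + q)) \<noteq> 0"
proof
  define c where "c a = (SOME i. q \<le> a i)" for a :: "'n \<Rightarrow> nat"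
  define g :: "'n \<Rightarrow> ('n, 'k) mfps" where "g i = Abs_mfps (\<lambda>b.
    if c (b(i := b i + q)) = i then mfps_coeff h (b(i := b i + q)) else 0)" for i
  have g: "mfps_coeff (g i) b =
      (if c (b(i := b i + q)) = i then mfps_coeff h (b(i := b i + q)) else 0)" for i b
    by (simp add: g_def Abs_mfps_inverse)
  show "mfps_coeff h (b(i := b i + q)) \<noteq> 0" if "mfps_coeff (g i) b \<noteq> 0" for i b
    using that by (auto simp: g split: if_splits)
  show "h = (\<Sum>i\<in>UNIV. mfps_var i ^ q * g i)"
  proof (rule mfps_eqI)
    fix a
    have "mfps_coeff (mfps_var i ^ q * g i) a =
        (if i = c a then if q \<le> a (c a) then mfps_coeff h a else 0 else 0)" for i
      by (auto simp: mfps_coeff_var_power_mult g)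
    moreover have "q \<le> a (c a)" if "mfps_coeff h a \<noteq> 0"
      unfolding c_def by (rule someI_ex) (rule assms[OF that])
    ultimately show "mfps_coeff h a = mfps_coeff (\<Sum>i\<in>UNIV. mfps_var i ^ q * g i) a"
      by auto
  qed
qed


section \<open>Ideals\<close>

lemma mfps_ring_simps [simp]:
  "carrier (ring_of_type_algebra :: 'a::comm_ring_1 ring) = UNIV"
  "x \<otimes>\<^bsub>ring_of_type_algebra\<^esub> y = x * (y :: 'a)"
  "x \<oplus>\<^bsub>ring_of_type_algebra\<^esub> y = x + (y :: 'a)"
  "\<one>\<^bsub>ring_of_type_algebra\<^esub> = (1 :: 'a)"
  "\<zero>\<^bsub>ring_of_type_algebra\<^esub> = (0 :: 'a)"
  by (simp_all add: ring_of_type_algebra_def)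

interpretation type_ring: cring "ring_of_type_algebra :: 'a::comm_ring_1 ring"
  by (rule cring_from_type_algebra)

lemma type_ring_uminus: "\<ominus>\<^bsub>ring_of_type_algebra\<^esub> x = - (x :: 'a::comm_ring_1)"
  using type_ring.r_neg[of x] by (simp add: eq_neg_iff_add_eq_0 add.commute)

lemma type_ring_minus: "x \<ominus>\<^bsub>ring_of_type_algebra\<^esub> y = x - (y :: 'a::comm_ring_1)"
  by (simp add: a_minus_def type_ring_uminus)

lemma ideal_type_ringI:
  fixes I :: "'a::comm_ring_1 set"
  assumes "0 \<in> I" "\<And>x y. x \<in> I \<Longrightarrow> y \<in> I \<Longrightarrow> x + y \<in> I" "\<And>r x. x \<in> I \<Longrightarrow> r * x \<in> I"
  shows "ideal I ring_of_type_algebra"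
proof (rule idealI)
  show "ring (ring_of_type_algebra :: 'a ring)" ..
  show "subgroup I (add_monoid ring_of_type_algebra)"
    using assms assms(3)[where r = "-1"]
    by (intro type_ring.add.subgroupI) (auto simp: type_ring_uminus simp flip: a_inv_def)
qed (use assms in \<open>auto simp: mult.commute\<close>)

lemma ideal_type_ringD:
  fixes I :: "'a::comm_ring_1 set"
  assumes "ideal I ring_of_type_algebra"
  shows "0 \<in> I" "x \<in> I \<Longrightarrow> y \<in> I \<Longrightarrow> x + y \<in> I" "x \<in> I \<Longrightarrow> r * x \<in> I"
    "x \<in> I \<Longrightarrow> x * r \<in> I"
    "x \<in> I \<Longrightarrow> y \<in> I \<Longrightarrow> x - y \<in> I"
    "(\<And>i. i \<in> A \<Longrightarrow> f i \<in> I) \<Longrightarrow> sum f A \<in> I"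
proof -
  interpret ideal I "ring_of_type_algebra :: 'a ring" by fact
  show zero: "0 \<in> I" using zero_closed by simp
  show add: "x \<in> I \<Longrightarrow> y \<in> I \<Longrightarrow> x + y \<in> I" for x y using a_closed by simp
  show mult: "x \<in> I \<Longrightarrow> r * x \<in> I" for x r using I_l_closed[of x r] by simp
  then show "x \<in> I \<Longrightarrow> x * r \<in> I" by (metis mult.commute)
  show "x \<in> I \<Longrightarrow> y \<in> I \<Longrightarrow> x - y \<in> I" using add[of x "- 1 * y"] mult[of y "- 1"] by simp
  show "(\<And>i. i \<in> A \<Longrightarrow> f i \<in> I) \<Longrightarrow> sum f A \<in> I"
    by (induction A rule: infinite_finite_induct) (auto intro: zero add)
qed

section \<open>Ideals given by vanishing coefficients\<close>

definition vanishing_on :: "('n \<Rightarrow> nat) set \<Rightarrow> ('n::finite, 'k::zero) mfps set"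
  where "vanishing_on D = {h. \<forall>a\<in>D. mfps_coeff h a = 0}"

text \<open>The coefficient of \<open>r * x\<close> at \<open>a\<close> only involves coefficients
  of \<open>x\<close> at exponents \<open>a - b\<close>, which stay in the downward closed set
  \<open>D\<close>.\<close>

lemma ideal_vanishing_on:
  assumes "\<And>a b. a \<in> D \<Longrightarrow> b \<le> a \<Longrightarrow> b \<in> D"
  shows "ideal (vanishing_on D :: ('n::finite, 'k::comm_ring_1) mfps set) mfps_ring"
proof (rule ideal_type_ringI)
  fix r x :: "('n, 'k) mfps" assume x: "x \<in> vanishing_on D"
  have "a - b \<in> D" if "a \<in> D" for a b
    using assms[OF that] by (simp add: le_fun_def)
  with x show "r * x \<in> vanishing_on D"
    by (auto simp: vanishing_on_def mfps_coeff_mult)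
qed (auto simp: vanishing_on_def)

lemma genideal_type_ring:
  fixes S :: "'a::comm_ring_1 set"
  shows "ideal (Idl\<^bsub>ring_of_type_algebra\<^esub> S) ring_of_type_algebra"
    and "x \<in> S \<Longrightarrow> x \<in> Idl\<^bsub>ring_of_type_algebra\<^esub> S"
    and "ideal I ring_of_type_algebra \<Longrightarrow> S \<subseteq> I \<Longrightarrow> Idl\<^bsub>ring_of_type_algebra\<^esub> S \<subseteq> I"
  using type_ring.genideal_ideal[of S] type_ring.genideal_self[of S] type_ring.genideal_minimal[of I S]
  by auto

text \<open>
  \<open>order_ideal d\<close> is \<open>\<mm>\<^sup>d\<close>, and \<open>box_ideal q\<close> is \<open>\<mm>\<^sup>[\<^sup>q\<^sup>]\<close> when \<open>q\<close> is a power of the characteristic.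
\<close>
definition order_ideal :: "nat \<Rightarrow> ('n::finite, 'k::zero) mfps set"
  where "order_ideal d = vanishing_on {a. sum a UNIV < d}"

definition box_ideal :: "nat \<Rightarrow> ('n::finite, 'k::zero) mfps set"
  where "box_ideal q = vanishing_on {a. \<forall>i. a i < q}"

lemma ideal_order_ideal: "ideal (order_ideal d :: ('n::finite, 'k::comm_ring_1) mfps set) mfps_ring"
  unfolding order_ideal_def
proof (rule ideal_vanishing_on)
  fix a b :: "'n \<Rightarrow> nat" assume "a \<in> {a. sum a UNIV < d}" "b \<le> a"
  moreover from this have "sum b UNIV \<le> sum a UNIV"
    by (intro sum_mono) (simp add: le_fun_def)
  ultimately show "b \<in> {a. sum a UNIV < d}" by simp
qed

lemma ideal_box_ideal: "ideal (box_ideal q :: ('n::finite, 'k::comm_ring_1) mfps set) mfps_ring"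
  unfolding box_ideal_def
  by (rule ideal_vanishing_on) (auto simp: le_fun_def intro: le_less_trans)

lemma order_ideal_antimono: "d \<le> e \<Longrightarrow> order_ideal e \<subseteq> order_ideal d"
  by (auto simp: order_ideal_def vanishing_on_def)

lemma order_ideal_1: "order_ideal 1 = box_ideal 1"
  by (simp add: order_ideal_def box_ideal_def)

lemma box_ideal_splitE:
  fixes h :: "('n::finite, 'k::comm_ring_1) mfps"
  assumes "h \<in> box_ideal q"
  obtains g where "h = (\<Sum>i\<in>UNIV. mfps_var i ^ q * g i)"
proof -
  have "\<exists>i. q \<le> a i" if "mfps_coeff h a \<noteq> 0" for a
    using assms that by (auto simp: box_ideal_def vanishing_on_def) (metis not_less)
  from mfps_splitE[of h, OF this] show ?thesis using that by metis
qed

lemma mfps_var_power_in_box_ideal: "mfps_var i ^ q \<in> (box_ideal q :: ('n::finite, 'k::comm_ring_1) mfps set)"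
  by (auto simp: box_ideal_def vanishing_on_def mfps_var_power mfps_coeff_monom)

text \<open>Dividing a term of degree at least \<open>Suc d\<close> by a variable that occurs in it
  leaves degree at least \<open>d\<close>. This feeds the Nakayama argument.\<close>

lemma order_ideal_SucE:
  fixes h :: "('n::finite, 'k::comm_ring_1) mfps"
  assumes "h \<in> order_ideal (Suc d)"
  obtains g where "h = (\<Sum>i\<in>UNIV. mfps_var i * g i)" "\<forall>i. g i \<in> order_ideal d"
proof -
  have "\<exists>i. 1 \<le> a i" if "mfps_coeff h a \<noteq> 0" for a
  proof (rule ccontr)
    assume "\<not> ?thesis"
    then have "a = (\<lambda>_. 0)" by (auto simp: not_le)
    with assms that show False by (auto simp: order_ideal_def vanishing_on_def)
  qed
  then obtain g where g: "h = (\<Sum>i\<in>UNIV. mfps_var i ^ 1 * g i)"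
    "\<And>i b. mfps_coeff (g i) b \<noteq> 0 \<Longrightarrow> mfps_coeff h (b(i := b i + 1)) \<noteq> 0"
    using mfps_splitE[of h 1] by metis
  have "g i \<in> order_ideal d" for i
  proof -
    have "mfps_coeff (g i) b = 0" if "sum b UNIV < d" for b
    proof (rule ccontr)
      assume "mfps_coeff (g i) b \<noteq> 0"
      then have "mfps_coeff h (b(i := b i + 1)) \<noteq> 0" by (rule g(2))
      moreover have "sum (b(i := b i + 1)) UNIV = Suc (sum b UNIV)"
        using sum.remove[of UNIV i b] sum.remove[of UNIV i "b(i := b i + 1)"] by simp
      ultimately show False
        using assms that by (auto simp: order_ideal_def vanishing_on_def)
    qed
    then show ?thesis by (simp add: order_ideal_def vanishing_on_def)
  qed
  with g(1) show ?thesis using that by simp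
qed

text \<open>Turns membership in the generated ideal into a condition on coefficients; the harder
  inclusion splits off one variable from each term.\<close>

lemma maximal_ideal_eq: "maximal_ideal = (box_ideal 1 :: ('n::finite, 'k::comm_ring_1) mfps set)"
proof
  show "maximal_ideal \<subseteq> (box_ideal 1 :: ('n, 'k) mfps set)"
    unfolding maximal_ideal_def
    using mfps_var_power_in_box_ideal[of _ 1]
    by (intro genideal_type_ring ideal_box_ideal) auto
next
  show "(box_ideal 1 :: ('n, 'k) mfps set) \<subseteq> maximal_ideal"
  proof
    fix h :: "('n, 'k) mfps" assume "h \<in> box_ideal 1"
    then obtain g where g: "h = (\<Sum>i\<in>UNIV. mfps_var i ^ 1 * g i)"
      by (rule box_ideal_splitE)
    have "(\<Sum>i\<in>UNIV. mfps_var i ^ 1 * g i) \<in> maximal_ideal"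
      unfolding maximal_ideal_def
      by (intro ideal_type_ringD(4,6)[OF genideal_type_ring(1)]) (auto intro: genideal_type_ring(2))
    with g show "h \<in> maximal_ideal" by simp
  qed
qed

text \<open>Frobenius is additive in characteristic \<open>p\<close>, so it acts on each summand
  \<open>mfps_var i ^ q * g i\<close> separately.\<close>

lemma box_ideal_power_CHAR:
  fixes h :: "('n::finite, 'k::field) mfps"
  assumes "CHAR('k) > 0" "h \<in> box_ideal q"
  shows "h ^ (CHAR('k) ^ e) \<in> box_ideal (CHAR('k) ^ e * q)"
proof -
  obtain g where "h = (\<Sum>i\<in>UNIV. mfps_var i ^ q * g i)"
    using assms(2) by (rule box_ideal_splitE)
  then have "h ^ (CHAR('k) ^ e) = (\<Sum>i\<in>UNIV. mfps_var i ^ (CHAR('k) ^ e * q) * g i ^ (CHAR('k) ^ e))"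
    by (simp add: freshmans_dream_sum'[OF prime_CHAR_mfps[OF assms(1)], of _ e] CHAR_mfps
      power_mult_distrib mult.commute flip: power_mult)
  then show ?thesis
    by (simp add: ideal_type_ringD(4,6)[OF ideal_box_ideal] mfps_var_power_in_box_ideal)
qed

text \<open>One inclusion is \<open>box_ideal_power_CHAR\<close> with \<open>q = 1\<close>;
  conversely, a series in the box ideal splits into multiples of powers of the variables, and these
  powers are among the generators.\<close>

lemma frobenius_power_maximal_ideal:
  assumes "CHAR('k::field) > 0"
  shows "frobenius_power maximal_ideal (CHAR('k) ^ e) =
    (box_ideal (CHAR('k) ^ e) :: ('n::finite, 'k) mfps set)"
    (is "frobenius_power _ ?q = _")
proof
  show "frobenius_power maximal_ideal ?q \<subseteq> (box_ideal ?q :: ('n, 'k) mfps set)"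
    unfolding frobenius_power_def maximal_ideal_eq
    using box_ideal_power_CHAR[OF assms, of _ 1 e]
    by (intro genideal_type_ring ideal_box_ideal image_subsetI) simp
next
  show "box_ideal ?q \<subseteq> (frobenius_power maximal_ideal ?q :: ('n, 'k) mfps set)"
  proof
    fix h :: "('n, 'k) mfps" assume "h \<in> box_ideal ?q"
    then obtain g where g: "h = (\<Sum>i\<in>UNIV. mfps_var i ^ ?q * g i)"
      by (rule box_ideal_splitE)
    have "mfps_var i \<in> (maximal_ideal :: ('n, 'k) mfps set)" for i
      unfolding maximal_ideal_def by (rule genideal_type_ring(2)) simp
    then have "(\<Sum>i\<in>UNIV. mfps_var i ^ ?q * g i) \<in> frobenius_power maximal_ideal ?q"
      unfolding frobenius_power_def
      by (intro ideal_type_ringD(4,6)[OF genideal_type_ring(1)]) (auto intro: genideal_type_ring(2))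
    with g show "h \<in> frobenius_power maximal_ideal ?q" by simp
  qed
qed


section \<open>Powers and orders\<close>

lemma mfps_const_power: "mfps_const c ^ n = (mfps_const (c ^ n) :: ('n::finite, 'k::comm_ring_1) mfps)"
  by (induction n) (simp_all add: mfps_const_one mfps_const_mult)

text \<open>
  Modulo \<open>box_ideal q\<close> the series \<open>h\<close> is a polynomial, whose \<open>p\<close>-th power is computed termwise.
\<close>
lemma power_CHAR_notin_box_ideal:
  fixes h :: "('n::finite, 'k::field) mfps"
  assumes "CHAR('k) > 0" "h \<notin> box_ideal q"
  shows "h ^ CHAR('k) \<notin> box_ideal (CHAR('k) * q)"
proof -
  define p where "p = CHAR('k)"
  have p: "p > 0" "CHAR('k) > 0" using assms(1) by (simp_all add: p_def)
  obtain a where a: "\<forall>i. a i < q" "mfps_coeff h a \<noteq> 0"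
    using assms(2) by (auto simp: box_ideal_def vanishing_on_def)
  define B where "B = {b :: 'n \<Rightarrow> nat. \<forall>i. b i < q}"
  have "finite B"
    using finite_exponents_le[of "\<lambda>_. q"]
  proof (rule rev_finite_subset)
    show "B \<subseteq> {..\<lambda>_. q}"
      by (simp add: B_def le_fun_def less_imp_le subset_iff)
  qed
  \<comment> \<open>The part of \<open>h\<close> inside the box; Frobenius sends the remainder
    \<open>h - h1\<close> into the larger box ideal.\<close>
  define h1 where "h1 = (\<Sum>b\<in>B. mfps_const (mfps_coeff h b) * mfps_monom b :: ('n, 'k) mfps)"
  have "mfps_coeff h1 b = mfps_coeff h b" if "b \<in> B" for b
    using \<open>finite B\<close> that by (simp add: h1_def mfps_coeff_monom if_distrib cong: if_cong)
  then have "h - h1 \<in> box_ideal q"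
    by (auto simp: box_ideal_def vanishing_on_def B_def)
  from box_ideal_power_CHAR[OF p(2) this, of 1]
  have r: "(h - h1) ^ p \<in> box_ideal (p * q)"
    by (simp add: p_def)
  have h1p: "h1 ^ p = (\<Sum>b\<in>B. mfps_const (mfps_coeff h b ^ p) * mfps_monom (\<lambda>i. p * b i))"
    unfolding h1_def
    by (simp add: freshmans_dream_sum[OF prime_CHAR_mfps[OF p(2)]] CHAR_mfps p_def
        power_mult_distrib mfps_const_power mfps_monom_power)
  \<comment> \<open>Exponents scaled by \<open>p\<close> remain distinct, so nothing cancels at
    \<open>p\<close> times \<open>a\<close>.\<close>
  have "(\<lambda>i. p * a i) = (\<lambda>i. p * b i) \<longleftrightarrow> b = a" for b
    using p(1) by (auto simp: fun_eq_iff)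
  then have "mfps_coeff (h1 ^ p) (\<lambda>i. p * a i) = (\<Sum>b\<in>B. if b = a then mfps_coeff h b ^ p else 0)"
    unfolding h1p by (simp add: mfps_coeff_monom if_distrib cong: if_cong)
  also have "\<dots> = mfps_coeff h a ^ p"
    using \<open>finite B\<close> a(1) by (simp add: B_def)
  finally have "mfps_coeff (h1 ^ p) (\<lambda>i. p * a i) \<noteq> 0"
    using a(2) by simp
  moreover have "mfps_coeff ((h - h1) ^ p) (\<lambda>i. p * a i) = 0"
    using r a(1) p(1) by (simp add: box_ideal_def vanishing_on_def)
  moreover have "h ^ p = (h - h1) ^ p + h1 ^ p"
    using freshmans_dream[OF prime_CHAR_mfps[OF p(2)], of p "h - h1" h1] by (simp add: CHAR_mfps p_def)
  ultimately have "mfps_coeff (h ^ p) (\<lambda>i. p * a i) \<noteq> 0" by simp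
  then show ?thesis
    using a(1) p(1) unfolding p_def[symmetric] box_ideal_def vanishing_on_def by force
qed

text \<open>
  Lexicographic minimisation, one variable after the other, encoded in a single additive weight.
\<close>
lemma generic_weight:
  fixes S :: "('n::finite \<Rightarrow> nat) set"
  assumes "S \<noteq> {}"
  obtains w a0 where "a0 \<in> S" "\<forall>a\<in>S. sum a0 UNIV \<le> sum a UNIV"
    "\<forall>a\<in>S. (\<Sum>i\<in>UNIV. w i * a0 i) \<le> (\<Sum>i\<in>UNIV. w i * a i :: nat)"
    "\<forall>a\<in>S. (\<Sum>i\<in>UNIV. w i * a i) = (\<Sum>i\<in>UNIV. w i * a0 i) \<longrightarrow> a = a0"
proof -
  define W where "W w a = (\<Sum>i\<in>UNIV. w i * a i)" for w a :: "'n \<Rightarrow> nat"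
  \<comment> \<open>Induction over the set \<open>I\<close> of variables treated so far: minimal
    weight determines the total degree and the entries in \<open>I\<close>.\<close>
  have "\<exists>w a0. a0 \<in> S \<and> (\<forall>a\<in>S. sum a0 UNIV \<le> sum a UNIV) \<and> (\<forall>a\<in>S. W w a0 \<le> W w a \<and>
      (W w a = W w a0 \<longrightarrow> sum a UNIV = sum a0 UNIV \<and> (\<forall>i\<in>I. a i = a0 i)))" if "finite I" for I
    using that
  proof induction
    case empty
    obtain a0 where "a0 \<in> S" "\<forall>a\<in>S. sum a0 UNIV \<le> sum a UNIV"
      using assms ex_has_least_nat[of "\<lambda>a. a \<in> S" _ "\<lambda>a. sum a UNIV"] by blast
    \<comment> \<open>The weight starts as the total degree, so that degree is minimised
      first.\<close>
    then show ?case
      by (intro exI[of _ "\<lambda>_. 1"] exI[of _ a0]) (simp add: W_def)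
  next
    case (insert x I)
    then obtain w a0 where a0: "a0 \<in> S" "\<And>a. a \<in> S \<Longrightarrow> sum a0 UNIV \<le> sum a UNIV"
      "\<And>a. a \<in> S \<Longrightarrow> W w a0 \<le> W w a"
      "\<And>a. a \<in> S \<Longrightarrow> W w a = W w a0 \<Longrightarrow> sum a UNIV = sum a0 UNIV"
      "\<And>a i. a \<in> S \<Longrightarrow> W w a = W w a0 \<Longrightarrow> i \<in> I \<Longrightarrow> a i = a0 i"
      by blast
    obtain a1 where a1: "a1 \<in> S" "W w a1 = W w a0"
      "\<And>a. a \<in> S \<Longrightarrow> W w a = W w a0 \<Longrightarrow> a1 x \<le> a x"
      using ex_has_least_nat[of "\<lambda>a. a \<in> S \<and> W w a = W w a0" a0 "\<lambda>a. a x"] a0(1) by blast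
    \<comment> \<open>The factor \<open>a1 x + 1\<close> makes one unit of the old weight outweigh
      the entry \<open>a1 x\<close>, so at the minimum the variable \<open>x\<close> only breaks
      ties.\<close>
    define w' where "w' i = (a1 x + 1) * w i + (if i = x then 1 else 0)" for i
    have W': "W w' a = (a1 x + 1) * W w a + a x" for a
    proof -
      have "w' i * a i = (a1 x + 1) * (w i * a i) + (if i = x then a x else 0)" for i
        by (simp add: w'_def algebra_simps)
      then show ?thesis
        by (simp add: W_def sum.distrib sum_distrib_left)
    qed
    have *: "W w' a1 \<le> W w' a \<and> (W w' a = W w' a1 \<longrightarrow> W w a = W w a0 \<and> a x = a1 x)"
      if "a \<in> S" for a
    proof (cases "W w a = W w a0")
      case True
      then show ?thesis using a1(2) a1(3)[OF that] by (simp add: W')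
    next
      case False
      then have "W w a0 + 1 \<le> W w a" using a0(3)[OF that] by simp
      then have "(a1 x + 1) * (W w a0 + 1) \<le> (a1 x + 1) * W w a" by (rule mult_le_mono2)
      then show ?thesis using a1(2) by (simp add: W' algebra_simps)
    qed
    have sum_a1: "sum a1 UNIV = sum a0 UNIV" by (rule a0(4)[OF a1(1,2)])
    have min: "\<forall>a\<in>S. W w' a1 \<le> W w' a \<and>
        (W w' a = W w' a1 \<longrightarrow> sum a UNIV = sum a1 UNIV \<and> (\<forall>i\<in>insert x I. a i = a1 i))"
    proof (rule ballI, intro conjI impI)
      fix a assume that: "a \<in> S"
      show "W w' a1 \<le> W w' a" using *[OF that] by (rule conjunct1)
      assume "W w' a = W w' a1"
      then have eq: "W w a = W w a0" "a x = a1 x" using *[OF that] by simp_all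
      show "sum a UNIV = sum a1 UNIV" using a0(4)[OF that eq(1)] sum_a1 by simp
      show "\<forall>i\<in>insert x I. a i = a1 i"
        using a0(5)[OF that eq(1)] a0(5)[OF a1(1,2)] eq(2) by simp
    qed
    have "\<forall>a\<in>S. sum a1 UNIV \<le> sum a UNIV" using a0(2) sum_a1 by simp
    with a1(1) min show ?case
      by (intro exI[of _ w'] exI[of _ a1] conjI)
  qed
  from this[of UNIV, OF finite_UNIV] obtain w a0 where a0: "a0 \<in> S" "\<forall>a\<in>S. sum a0 UNIV \<le> sum a UNIV"
    "\<forall>a\<in>S. W w a0 \<le> W w a \<and>
      (W w a = W w a0 \<longrightarrow> sum a UNIV = sum a0 UNIV \<and> (\<forall>i\<in>UNIV. a i = a0 i))"
    by (elim exE conjE) (rule that)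
  show ?thesis
  proof (rule that[of a0 w])
    show "a0 \<in> S" "\<forall>a\<in>S. sum a0 UNIV \<le> sum a UNIV" by fact+
    show "\<forall>a\<in>S. (\<Sum>i\<in>UNIV. w i * a0 i) \<le> (\<Sum>i\<in>UNIV. w i * a i)"
      using a0(3) unfolding W_def by blast
    show "\<forall>a\<in>S. (\<Sum>i\<in>UNIV. w i * a i) = (\<Sum>i\<in>UNIV. w i * a0 i) \<longrightarrow> a = a0"
      using a0(3) unfolding W_def fun_eq_iff by blast
  qed
qed

text \<open>All other exponents of \<open>f\<close> weigh strictly more than \<open>a0\<close>, so
  \<open>N\<close> exponents of \<open>f\<close> can add up to \<open>N\<close> times
  \<open>a0\<close> only if each of them is \<open>a0\<close>; nothing cancels there.\<close>

lemma mfps_coeff_power_min_weight: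
  fixes f :: "('n::finite, 'k::comm_ring_1) mfps" and w a0 :: "'n \<Rightarrow> nat"
  defines "W \<equiv> \<lambda>a. \<Sum>i\<in>UNIV. w i * a i"
  assumes min: "\<And>a. mfps_coeff f a \<noteq> 0 \<Longrightarrow> W a0 \<le> W a"
    and uniq: "\<And>a. mfps_coeff f a \<noteq> 0 \<Longrightarrow> W a = W a0 \<Longrightarrow> a = a0"
  shows "mfps_coeff (f ^ N) (\<lambda>i. N * a0 i) = mfps_coeff f a0 ^ N"
proof -
  have W_add: "W b = W c + W (b - c)" if "c \<le> b" for b c
  proof -
    have "w i * b i = w i * c i + w i * (b - c) i" for i
      using that by (simp add: le_fun_def flip: distrib_left)
    then show ?thesis by (simp add: W_def flip: sum.distrib)
  qed
  have W_scale: "W (\<lambda>i. N * a0 i) = N * W a0" for N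
    by (simp add: W_def sum_distrib_left algebra_simps)
  \<comment> \<open>The second conjunct is the unique minimality for \<open>f ^ N\<close>; it
    carries the induction.\<close>
  have "mfps_coeff (f ^ N) (\<lambda>i. N * a0 i) = mfps_coeff f a0 ^ N \<and> (\<forall>b. mfps_coeff (f ^ N) b \<noteq> 0 \<longrightarrow>
      N * W a0 \<le> W b \<and> (W b = N * W a0 \<longrightarrow> b = (\<lambda>i. N * a0 i)))"
  proof (induction N)
    case 0
    show ?case by (simp add: mfps_coeff_one)
  next
    case (Suc N)
    \<comment> \<open>Weights are additive, so a sum of minimal weight has both summands
      minimal.\<close>
    have key: "W b \<ge> Suc N * W a0 \<and> (W b = Suc N * W a0 \<longrightarrow> c = a0 \<and> b - c = (\<lambda>i. N * a0 i))"
      if "c \<le> b" "mfps_coeff f c * mfps_coeff (f ^ N) (b - c) \<noteq> 0" for b c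
    proof -
      have nz: "mfps_coeff f c \<noteq> 0" "mfps_coeff (f ^ N) (b - c) \<noteq> 0" using that(2) by auto
      have "W a0 \<le> W c" "N * W a0 \<le> W (b - c)" using nz min Suc.IH by blast+
      moreover have "W c = W a0 \<Longrightarrow> c = a0" "W (b - c) = N * W a0 \<Longrightarrow> b - c = (\<lambda>i. N * a0 i)"
        using nz uniq Suc.IH by blast+
      moreover have "W b = W c + W (b - c)" "Suc N * W a0 = W a0 + N * W a0"
        using W_add[OF that(1)] by simp_all
      ultimately show ?thesis by (intro conjI impI) linarith+
    qed
    have "W b \<ge> Suc N * W a0 \<and> (W b = Suc N * W a0 \<longrightarrow> b = (\<lambda>i. Suc N * a0 i))"
      if "mfps_coeff (f ^ Suc N) b \<noteq> 0" for b
    proof -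
      have "(\<Sum>c\<in>{..b}. mfps_coeff f c * mfps_coeff (f ^ N) (b - c)) \<noteq> 0"
        using that unfolding power_Suc mfps_coeff_mult .
      then obtain c where "c \<in> {..b}" and c2: "mfps_coeff f c * mfps_coeff (f ^ N) (b - c) \<noteq> 0"
        by (rule sum.not_neutral_contains_not_neutral)
      then have c: "c \<le> b" by simp
      have "b = (\<lambda>i. Suc N * a0 i)" if "c = a0" "b - c = (\<lambda>i. N * a0 i)"
      proof
        fix i
        have "b i - c i = N * a0 i" using fun_cong[OF that(2), of i] by simp
        moreover have "c i \<le> b i" using c by (simp add: le_fun_def)
        ultimately show "b i = Suc N * a0 i" using that(1) by simp
      qed
      with key[OF c c2] show ?thesis by blast
    qed
    moreover have "mfps_coeff (f ^ Suc N) (\<lambda>i. Suc N * a0 i) = mfps_coeff f a0 ^ Suc N"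
    proof -
      let ?b = "\<lambda>i. Suc N * a0 i"
      have "a0 \<le> ?b" by (simp add: le_fun_def)
      have b: "?b - a0 = (\<lambda>i. N * a0 i)" by (simp add: fun_eq_iff)
      have "mfps_coeff (f ^ Suc N) ?b = (\<Sum>c\<in>{..?b}. mfps_coeff f c * mfps_coeff (f ^ N) (?b - c))"
        by (simp only: power_Suc mfps_coeff_mult)
      also have "\<dots> = (\<Sum>c\<in>{..?b}. if c = a0 then mfps_coeff f a0 * mfps_coeff (f ^ N) (?b - a0) else 0)"
        using key[of _ ?b] W_scale[of "Suc N"] by (intro sum.cong) auto
      also have "\<dots> = mfps_coeff f a0 ^ Suc N"
        using \<open>a0 \<le> ?b\<close> Suc.IH unfolding b by (simp add: finite_exponents_le)
      finally show ?thesis .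
    qed
    ultimately show ?case by blast
  qed
  then show ?thesis by blast
qed

text \<open>The leading exponent \<open>a0\<close> of \<open>f\<close> has degree at most
  \<open>d\<close>, so the entries of \<open>N\<close> times \<open>a0\<close> are at most
  \<open>N * d < q\<close>, and the coefficient there is a power of a nonzero one.\<close>

lemma power_notin_box_ideal:
  fixes f :: "('n::finite, 'k::field) mfps"
  assumes "f \<notin> order_ideal (Suc d)" "N * d < q"
  shows "f ^ N \<notin> box_ideal q"
proof -
  define S where "S = {a. mfps_coeff f a \<noteq> 0}"
  obtain b where b: "b \<in> S" "sum b UNIV \<le> d"
    using assms(1) by (auto simp: order_ideal_def vanishing_on_def S_def)
  from b(1) have "S \<noteq> {}" by blast
  then obtain w a0 where a0: "a0 \<in> S" "\<forall>a\<in>S. sum a0 UNIV \<le> sum a UNIV"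
    "\<forall>a\<in>S. (\<Sum>i\<in>UNIV. w i * a0 i) \<le> (\<Sum>i\<in>UNIV. w i * a i :: nat)"
    "\<forall>a\<in>S. (\<Sum>i\<in>UNIV. w i * a i) = (\<Sum>i\<in>UNIV. w i * a0 i) \<longrightarrow> a = a0"
    by (rule generic_weight)
  have "mfps_coeff (f ^ N) (\<lambda>i. N * a0 i) = mfps_coeff f a0 ^ N"
    by (rule mfps_coeff_power_min_weight[of f w]) (use a0(3,4) in \<open>auto simp: S_def\<close>)
  moreover have "N * a0 i < q" for i
  proof -
    have "a0 i \<le> sum a0 UNIV" by (rule member_le_sum) auto
    also have "\<dots> \<le> d" using a0(2) b by (meson order_trans)
    finally show ?thesis using assms(2) by (meson le_less_trans mult_le_mono2)
  qed
  ultimately show ?thesis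
    using a0(1) by (auto simp: box_ideal_def vanishing_on_def S_def intro!: exI[of _ "\<lambda>i. N * a0 i"])
qed

section \<open>Orders of products and powers\<close>

lemma order_ideal_mult:
  fixes f g :: "('n::finite, 'k::comm_ring_1) mfps"
  assumes "f \<in> order_ideal d" "g \<in> order_ideal e"
  shows "f * g \<in> order_ideal (d + e)"
proof -
  have "mfps_coeff f b * mfps_coeff g (a - b) = 0" if "sum a UNIV < d + e" "b \<le> a" for a b
  proof -
    have "sum b UNIV + sum (a - b) UNIV = sum a UNIV"
      using that(2) by (simp add: le_fun_def flip: sum.distrib)
    then have "sum b UNIV < d \<or> sum (a - b) UNIV < e" using that(1) by linarith
    then show ?thesis
      using assms by (auto simp: order_ideal_def vanishing_on_def)
  qed
  then show ?thesis
    by (auto simp: order_ideal_def vanishing_on_def mfps_coeff_mult)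
qed

lemma order_ideal_0 [simp]: "order_ideal 0 = UNIV"
  by (simp add: order_ideal_def vanishing_on_def)

lemma order_ideal_power:
  fixes f :: "('n::finite, 'k::comm_ring_1) mfps"
  assumes "f \<in> order_ideal d"
  shows "f ^ N \<in> order_ideal (N * d)"
  using order_ideal_mult[OF assms] by (induction N) simp_all

text \<open>Pigeonhole: in \<open>n\<close> variables, a term of degree at least
  \<open>n * q\<close> has some exponent at least \<open>q\<close>. This bounds
  \<open>frob_nu\<close>.\<close>

lemma order_ideal_subset_box_ideal:
  "order_ideal (card (UNIV :: 'n set) * q) \<subseteq> (box_ideal q :: ('n::finite, 'k::zero) mfps set)"
proof -
  have "sum a UNIV < card (UNIV :: 'n set) * q" if "\<forall>i. a i < q" for a :: "'n \<Rightarrow> nat"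
    using sum_bounded_above_strict[of UNIV a q] that by (simp add: finite_UNIV_card_ge_0)
  then show ?thesis
    by (auto simp: order_ideal_def box_ideal_def vanishing_on_def)
qed


section \<open>The F-pure threshold\<close>

text \<open>Justifies \<open>GREATEST\<close>: \<open>N = 0\<close> qualifies because
  \<open>1\<close> is not in the box ideal, and \<open>f ^ N\<close> has order at least
  \<open>N\<close>, hence lies in the box ideal once \<open>N\<close> reaches the number of
  variables times \<open>CHAR('k) ^ e\<close>.\<close>

lemma frob_nu:
  fixes f :: "('n::finite, 'k::field) mfps"
  assumes "CHAR('k) > 0" "f \<in> maximal_ideal"
  shows frob_nu_notin: "f ^ frob_nu f e \<notin> box_ideal (CHAR('k) ^ e)"
    and frob_nu_ge: "\<And>N. f ^ N \<notin> box_ideal (CHAR('k) ^ e) \<Longrightarrow> N \<le> frob_nu f e"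
    and frob_nu_le: "frob_nu f e \<le> card (UNIV :: 'n set) * CHAR('k) ^ e"
proof -
  let ?P = "\<lambda>N. f ^ N \<notin> box_ideal (CHAR('k) ^ e)"
  have nu: "frob_nu f e = Greatest ?P"
    by (simp add: frob_nu_def frobenius_power_maximal_ideal[OF assms(1)])
  have "f \<in> order_ideal 1" using assms(2) by (simp only: maximal_ideal_eq order_ideal_1)
  then have "f ^ N \<in> order_ideal N" for N using order_ideal_power[of f 1 N] by simp
  then have bound: "N \<le> card (UNIV :: 'n set) * CHAR('k) ^ e" if "?P N" for N
    using that order_ideal_subset_box_ideal order_ideal_antimono
    by (metis nle_le subset_iff)
  have "?P 0"
    using assms(1) by (auto simp: box_ideal_def vanishing_on_def mfps_coeff_one)
  then show notin: "?P (frob_nu f e)"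
    unfolding nu by (rule GreatestI_nat) (rule bound)
  show "N \<le> frob_nu f e" if "?P N" for N
    unfolding nu using that by (rule Greatest_le_nat) (rule bound)
  show "frob_nu f e \<le> card (UNIV :: 'n set) * CHAR('k) ^ e"
    using notin by (rule bound)
qed

text \<open>The value of \<open>lim\<close> is meaningful only with convergence, which holds because
  the sequence is nondecreasing and bounded by the number of variables.\<close>

lemma fpt_LIMSEQ:
  fixes f :: "('n::finite, 'k::field) mfps"
  assumes char: "CHAR('k) > 0" and f: "f \<in> maximal_ideal"
  shows "(\<lambda>e. real (frob_nu f e) / real (CHAR('k) ^ e)) \<longlonglongrightarrow> fpt f"
proof -
  define p where "p = CHAR('k)"
  define x where "x e = real (frob_nu f e) / real (p ^ e)" for e
  have p: "p > 0" using char by (simp add: p_def)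
  have "x e \<le> x (Suc e)" for e
  proof -
    \<comment> \<open>Frobenius keeps this power outside the box ideal, so \<open>frob_nu\<close>
      grows at least by the factor \<open>p\<close>.\<close>
    have "(f ^ frob_nu f e) ^ p \<notin> box_ideal (p * p ^ e)"
      unfolding p_def by (rule power_CHAR_notin_box_ideal[OF char frob_nu_notin[OF char f]])
    then have "frob_nu f e * p \<le> frob_nu f (Suc e)"
      using frob_nu_ge[OF char f, of "frob_nu f e * p" "Suc e"] by (simp add: power_mult p_def)
    then have "real (frob_nu f e) * real p \<le> real (frob_nu f (Suc e))"
      by (metis of_nat_le_iff of_nat_mult)
    then show ?thesis using p by (simp add: x_def field_simps)
  qed
  then have "incseq x" by (rule incseq_SucI)
  moreover have "x e \<le> real (card (UNIV :: 'n set))" for e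
  proof -
    have "real (frob_nu f e) \<le> real (card (UNIV :: 'n set)) * real (p ^ e)"
      using frob_nu_le[OF char f, of e] unfolding p_def by (metis of_nat_le_iff of_nat_mult)
    then show ?thesis using p by (simp add: x_def divide_le_eq)
  qed
  ultimately obtain L where L: "x \<longlonglongrightarrow> L"
    using incseq_convergent[of x] by blast
  moreover have "fpt f = L"
    using limI[OF L] by (simp add: fpt_def x_def[abs_def] p_def)
  ultimately show ?thesis
    by (simp add: x_def[abs_def] p_def)
qed

lemma fpt_nonneg:
  fixes f :: "('n::finite, 'k::field) mfps"
  assumes "CHAR('k) > 0" "f \<in> maximal_ideal"
  shows "fpt f \<ge> 0"
  by (rule LIMSEQ_le_const[OF fpt_LIMSEQ[OF assms]]) simp

text \<open>The largest \<open>N\<close> with \<open>N * d < p ^ e\<close> gives a power of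
  \<open>f\<close> outside the box ideal, and \<open>N / p ^ e\<close> tends to
  \<open>1 / d\<close>.\<close>

lemma fpt_ge_inverse_order:
  fixes f :: "('n::finite, 'k::field) mfps"
  assumes char: "CHAR('k) > 0" and f: "f \<in> maximal_ideal" "f \<notin> order_ideal (Suc d)"
  shows "fpt f \<ge> 1 / real d"
proof (cases "d = 0")
  \<comment> \<open>Here \<open>1 / real d\<close> is \<open>0\<close>, the value of division by
    zero.\<close>
  case True
  then show ?thesis using fpt_nonneg[OF char f(1)] by simp
next
  case False
  define p where "p = CHAR('k)"
  have "prime p" unfolding p_def by (rule prime_CHAR_semidom[OF char])
  then have p: "p > 1" by (rule prime_gt_1_nat)
  have "1 / real d - (1 / real p) ^ e \<le> real (frob_nu f e) / real (p ^ e)" for e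
  proof -
    define N where "N = (p ^ e - 1) div d"
    have "N * d \<le> p ^ e - 1" by (simp add: N_def)
    moreover have "p ^ e > 0" using p by simp
    ultimately have "N * d < p ^ e" by linarith
    then have "f ^ N \<notin> box_ideal (CHAR('k) ^ e)"
      unfolding p_def by (rule power_notin_box_ideal[OF f(2)])
    then have "N \<le> frob_nu f e" by (rule frob_nu_ge[OF char f(1)])
    \<comment> \<open>By maximality of \<open>N\<close>; hence \<open>N / p ^ e\<close> falls short
      of \<open>1 / d\<close> by at most \<open>1 / p ^ e\<close>.\<close>
    moreover have "p ^ e \<le> (N + 1) * d"
      using dividend_less_times_div[of d "p ^ e - 1"] False by (simp add: N_def algebra_simps)
    ultimately have "p ^ e \<le> (frob_nu f e + 1) * d"
      by (meson add_le_mono1 le_trans mult_le_mono1)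
    then have "real (p ^ e) \<le> (real (frob_nu f e) + 1) * real d"
      by (metis of_nat_1 of_nat_add of_nat_le_iff of_nat_mult)
    then have "real (p ^ e) / real d - 1 \<le> real (frob_nu f e)"
      using False by (simp add: field_simps)
    then have "(real (p ^ e) / real d - 1) / real (p ^ e) \<le> real (frob_nu f e) / real (p ^ e)"
      by (rule divide_right_mono) simp
    then show ?thesis using p by (simp add: diff_divide_distrib power_one_over)
  qed
  moreover have "(\<lambda>e. 1 / real d - (1 / real p) ^ e) \<longlonglongrightarrow> 1 / real d - 0"
    by (intro tendsto_intros LIMSEQ_power_zero) (use p in simp)
  ultimately show ?thesis
    using LIMSEQ_le[OF _ fpt_LIMSEQ[OF char f(1)], of _ "1 / real d - 0"] by (auto simp: p_def)
qed


section \<open>Dimensions of quotients\<close>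

lemma subfield_range_mfps_const:
  "subfield (range (mfps_const :: 'k::field \<Rightarrow> ('n::finite, 'k) mfps)) mfps_ring"
proof -
  interpret k: field "ring_of_type_algebra :: 'k ring" ..
  interpret c: ring_hom_ring "ring_of_type_algebra :: 'k ring" "mfps_ring :: ('n, 'k) mfps ring" mfps_const
    by (rule ring_hom_ringI)
      (auto simp: mfps_const_add mfps_const_mult mfps_const_one type_ring.ring_axioms)
  show ?thesis
    using c.img_is_subfield(2)[OF k.carrier_is_subfield] by simp
qed

text \<open>The dimension theory wants a subfield of scalars; \<open>1 \<notin> J\<close> makes the
  quotient nontrivial, so the constants still embed.\<close>

lemma subfield_quotient:
  fixes J :: "('n::finite, 'k::field) mfps set"
  assumes "ideal J mfps_ring" "1 \<notin> J"
  shows "subfield (range (\<lambda>c. J +>\<^bsub>mfps_ring\<^esub> mfps_const c)) (mfps_ring Quot J)"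
proof -
  interpret J: ideal J mfps_ring by fact
  interpret h: ring_hom_ring "mfps_ring :: ('n, 'k) mfps ring" "mfps_ring Quot J" "(+>\<^bsub>mfps_ring\<^esub>) J"
    by (rule J.rcos_ring_hom_ring)
  have "\<one>\<^bsub>mfps_ring Quot J\<^esub> \<noteq> \<zero>\<^bsub>mfps_ring Quot J\<^esub>"
    using J.rcos_const_imp_mem[of 1] assms(2) by (auto simp: FactRing_def)
  then show ?thesis
    using h.img_is_subfield(2)[OF subfield_range_mfps_const] by (simp add: image_image)
qed

text \<open>Linear combinations of \<open>us\<close> lie in \<open>S\<close>, and so does everything
  congruent to them modulo \<open>J\<close>, but \<open>u\<close> does not. Independent lists thus
  extend along a chain of ideals.\<close>

lemma independent_quotient_Cons:
  fixes J S :: "('n::finite, 'k::field) mfps set"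
  defines "h \<equiv> (+>\<^bsub>mfps_ring\<^esub>) J" and "Q \<equiv> mfps_ring Quot J"
  defines "K \<equiv> range (\<lambda>c. J +>\<^bsub>mfps_ring\<^esub> mfps_const c)"
  assumes J: "ideal J mfps_ring" "1 \<notin> J" and S: "ideal S mfps_ring" "J \<subseteq> S"
    and us: "set us \<subseteq> S" "u \<notin> S" "ring.independent Q K (map h us)"
  shows "ring.independent Q K (map h (u # us))"
proof -
  interpret J: ideal J mfps_ring by fact
  interpret S: ideal S mfps_ring by fact
  interpret h: ring_hom_ring "mfps_ring :: ('n, 'k) mfps ring" Q h
    unfolding Q_def h_def by (rule J.rcos_ring_hom_ring)
  let ?K0 = "range (mfps_const :: 'k \<Rightarrow> ('n, 'k) mfps)"
  have K: "K = h ` ?K0"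
    by (simp add: K_def h_def image_image)
  have "h u \<notin> h.S.Span K (map h us)"
  proof
    assume "h u \<in> h.S.Span K (map h us)"
    \<comment> \<open>Spans commute with the quotient map, so a relation lifts to a combination
      \<open>s\<close> of \<open>us\<close>.\<close>
    moreover have "h.S.Span K (map h us) = h ` type_ring.Span ?K0 us"
      unfolding K by (rule h.Span_hom) simp_all
    ultimately obtain s where s: "s \<in> type_ring.Span ?K0 us" "h u = h s"
      by (metis imageE)
    have "?K0 <#>\<^bsub>mfps_ring\<^esub> set us \<subseteq> S"
    proof
      fix x assume "x \<in> ?K0 <#>\<^bsub>mfps_ring\<^esub> set us"
      then obtain c v where "v \<in> set us" "x = mfps_const c * v"
        unfolding set_mult_def by auto
      then show "x \<in> S"
        using us(1) ideal_type_ringD(3)[OF S(1)] by blast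
    qed
    then have "type_ring.Span ?K0 us \<subseteq> S"
      by (intro type_ring.Span_min[OF subfield_range_mfps_const] S.a_subgroup) simp_all
    then have "s \<in> S" using s(1) by blast
    have "u - s \<in> J"
      using type_ring.quotient_eq_iff_same_a_r_cos[OF J(1), of u s] s(2)
      by (simp add: h_def type_ring_minus)
    then have "u - s + s \<in> S"
      using S(2) \<open>s \<in> S\<close> by (intro ideal_type_ringD(2)[OF S(1)]) auto
    then show False
      using us(2) by simp
  qed
  moreover have "h u \<in> carrier Q" by (rule h.hom_closed) simp
  ultimately show ?thesis
    unfolding list.map using us(3) by (intro h.S.independent.li_Cons)
qed

text \<open>
  Modulo \<open>J\<close>, the series \<open>1, x, \<dots>, x\<^sup>k\<^sup>-\<^sup>1, g\<close> are linearly independent for any variable \<open>x\<close>.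
\<close>
lemma quotient_dim_ge:
  fixes J :: "('n::finite, 'k::field) mfps set"
  assumes J: "ideal J mfps_ring" "J \<subseteq> order_ideal k" and g: "g \<in> order_ideal k" "g \<notin> J"
  shows "enat (Suc k) \<le> quotient_dim J"
proof -
  let ?R = "mfps_ring :: ('n, 'k) mfps ring"
  let ?Q = "?R Quot J" and ?K = "range (\<lambda>c. J +>\<^bsub>?R\<^esub> mfps_const c)" and ?h = "(+>\<^bsub>?R\<^esub>) J"
  interpret J: ideal J ?R by fact
  interpret h: ring_hom_ring ?R ?Q ?h
    by (rule J.rcos_ring_hom_ring)
  have one: "1 \<notin> J"
    using g(2) ideal_type_ringD(3)[OF J(1), of 1 g] by auto
  \<comment> \<open>The list starts with \<open>g\<close>; then powers of one variable are added,
    from exponent \<open>k - 1\<close> down to \<open>0\<close>, each lying outside the ideal that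
    contains the earlier entries.\<close>
  have "\<exists>us. length us = Suc m \<and> set us \<subseteq> order_ideal (k - m) \<and> h.S.independent ?K (map ?h us)"
    if "m \<le> k" for m
    using that
  proof (induction m)
    case 0
    have "h.S.independent ?K (map ?h [g])"
      by (rule independent_quotient_Cons[OF J(1) one J(1)]) (use g in auto)
    then show ?case
      using g by (intro exI[of _ "[g]"]) simp
  next
    case (Suc m)
    then obtain us where us: "length us = Suc m" "set us \<subseteq> order_ideal (k - m)"
      "h.S.independent ?K (map ?h us)" by auto
    \<comment> \<open>Any variable will do; the index type is nonempty.\<close>
    define i :: 'n where "i = undefined"
    define u :: "('n, 'k) mfps" where "u = mfps_var i ^ (k - Suc m)"
    have u: "mfps_coeff u ((\<lambda>_. 0)(i := k - Suc m)) = 1"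
      "\<And>a. sum a UNIV < k - Suc m \<Longrightarrow> mfps_coeff u a = 0"
      by (auto simp: u_def mfps_var_power mfps_coeff_monom)
    have "u \<notin> order_ideal (k - m)"
      using u(1) Suc.prems by (auto simp: order_ideal_def vanishing_on_def intro!: exI[of _ "(\<lambda>_. 0)(i := k - Suc m)"])
    then have "h.S.independent ?K (map ?h (u # us))"
      using us J(2) order_ideal_antimono[of "k - m" k]
      by (intro independent_quotient_Cons[OF J(1) one ideal_order_ideal[of "k - m"]]) auto
    moreover have "set (u # us) \<subseteq> order_ideal (k - Suc m)"
      using us(2) u(2) order_ideal_antimono[of "k - Suc m" "k - m"]
      by (auto simp: order_ideal_def vanishing_on_def)
    ultimately show ?case
      using us(1) by (intro exI[of _ "u # us"]) auto
  qed
  then obtain us where us: "length us = Suc k" "h.S.independent ?K (map ?h us)"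
    by blast
  have carrier: "set (map ?h us) \<subseteq> carrier ?Q"
    by auto
  \<comment> \<open>Without finite dimension, \<open>quotient_dim\<close> is infinite and the bound
    is immediate.\<close>
  have "Suc k \<le> h.S.dim ?K (carrier ?Q)" if fin: "h.S.finite_dimension ?K (carrier ?Q)"
  proof -
    have "h.S.dimension (h.S.dim ?K (carrier ?Q)) ?K (carrier ?Q)"
      using h.S.finite_dimensionE[OF subfield_quotient[OF J(1) one] fin] by (simp only: over_def)
    from h.S.independent_length_le_dimension[OF subfield_quotient[OF J(1) one] this us(2) carrier]
    show ?thesis
      by (simp only: length_map us(1))
  qed
  then show ?thesis
    by (simp add: quotient_dim_def Let_def)
qed


section \<open>Milnor and Tjurina numbers\<close>

text \<open>The inverse is the geometric series of \<open>u\<close>, whose partial sums stabilise in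
  each degree.\<close>

lemma unit_one_minus:
  fixes u :: "('n::finite, 'k::comm_ring_1) mfps"
  assumes "u \<in> order_ideal 1"
  obtains v where "(1 - u) * v = 1"
proof
  define s where "s N = (\<Sum>m<N. u ^ m)" for N
  \<comment> \<open>Powers of \<open>u\<close> beyond \<open>sum a UNIV\<close> have no coefficient
    at \<open>a\<close>, so \<open>Suc (sum a UNIV)\<close> terms suffice.\<close>
  define v where "v = Abs_mfps (\<lambda>a. mfps_coeff (s (Suc (sum a UNIV))) a)"
  have pow: "u ^ m \<in> order_ideal m" for m
    using order_ideal_power[OF assms, of m] by simp
  have s_eq: "mfps_coeff (s N) a = mfps_coeff v a" if "sum a UNIV < N" for N a
  proof -
    have "mfps_coeff (s N) a = (\<Sum>m<N. mfps_coeff (u ^ m) a)"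
      by (simp add: s_def)
    also have "\<dots> = (\<Sum>m<Suc (sum a UNIV). mfps_coeff (u ^ m) a)"
      using that pow by (intro sum.mono_neutral_right) (auto simp: order_ideal_def vanishing_on_def)
    finally show ?thesis
      by (simp add: v_def s_def Abs_mfps_inverse)
  qed
  \<comment> \<open>The error lies in every power of the maximal ideal and therefore
    vanishes.\<close>
  have "(1 - u) * v - 1 \<in> order_ideal N" for N
  proof -
    have "v - s N \<in> order_ideal N"
      using s_eq by (simp add: order_ideal_def vanishing_on_def)
    then have "(1 - u) * (v - s N) - u ^ N \<in> order_ideal N"
      by (rule ideal_type_ringD(5)[OF ideal_order_ideal ideal_type_ringD(3)[OF ideal_order_ideal] pow])
    moreover have "(1 - u) * s N = 1 - u ^ N"
      unfolding s_def by (rule one_diff_power_eq[symmetric])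
    ultimately show ?thesis
      by (simp add: right_diff_distrib[of "1 - u"])
  qed
  from this[of "Suc (sum a UNIV)" for a] have "mfps_coeff ((1 - u) * v - 1) a = 0" for a
    unfolding order_ideal_def vanishing_on_def by blast
  then show "(1 - u) * v = 1"
    by (metis mfps_eqI mfps_coeff_zero eq_iff_diff_eq_0)
qed

lemma pderiv_order_ideal:
  assumes "f \<in> order_ideal (Suc d)"
  shows "mfps_pderiv i f \<in> (order_ideal d :: ('n::finite, 'k::comm_ring_1) mfps set)"
proof -
  have "mfps_coeff (mfps_pderiv i f) a = 0" if "sum a UNIV < d" for a
  proof -
    have "sum (a(i := Suc (a i))) UNIV = Suc (sum a UNIV)"
      using sum.remove[of UNIV i a] sum.remove[of UNIV i "a(i := Suc (a i))"] by simp
    with that assms show ?thesis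
      by (simp add: mfps_coeff_pderiv order_ideal_def vanishing_on_def)
  qed
  then show ?thesis by (simp add: order_ideal_def vanishing_on_def)
qed

section \<open>The Jacobian and Tjurina ideals\<close>

lemma
  fixes f :: "('n::finite, 'k::comm_ring_1) mfps"
  shows ideal_jacobian_ideal: "ideal (jacobian_ideal f) mfps_ring"
    and ideal_tjurina_ideal: "ideal (tjurina_ideal f) mfps_ring"
    and tjurina_ideal_eq: "tjurina_ideal f = {j + r * f | j r. j \<in> jacobian_ideal f}"
proof -
  show J: "ideal (jacobian_ideal f) mfps_ring"
    unfolding jacobian_ideal_def by (rule genideal_type_ring)
  then show "ideal (tjurina_ideal f) mfps_ring"
    unfolding tjurina_ideal_def by (intro type_ring.add_ideals genideal_type_ring)
  have "Idl\<^bsub>mfps_ring\<^esub> {f} = {r * f | r. True}"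
    using type_ring.cgenideal_eq_genideal[of f] by (simp add: cgenideal_def)
  then show "tjurina_ideal f = {j + r * f | j r. j \<in> jacobian_ideal f}"
    by (auto simp: tjurina_ideal_def set_add_def')
qed

text \<open>
  Nakayama: \<open>f\<close> lies in \<open>\<mm>\<^sup>d\<^sup>+\<^sup>1 \<subseteq> \<mm> (Jac(f) + \<langle>f\<rangle>)\<close>, hence \<open>(1 - u) f\<close> lies in \<open>Jac(f)\<close> for some
  \<open>u\<close> in \<open>\<mm>\<close>.
\<close>
lemma mem_jacobian_ideal_if:
  fixes f :: "('n::finite, 'k::comm_ring_1) mfps"
  assumes "f \<in> order_ideal (Suc d)" "order_ideal d \<subseteq> tjurina_ideal f"
  shows "f \<in> jacobian_ideal f"
proof -
  obtain g where g: "f = (\<Sum>i\<in>UNIV. mfps_var i * g i)" "\<forall>i. g i \<in> order_ideal d"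
    using assms(1) by (rule order_ideal_SucE)
  have "\<forall>i. \<exists>j r. j \<in> jacobian_ideal f \<and> g i = j + r * f"
    using g(2) assms(2) unfolding tjurina_ideal_eq by blast
  then obtain j r where jr: "\<And>i. j i \<in> jacobian_ideal f" "\<And>i. g i = j i + r i * f"
    by metis
  \<comment> \<open>Substituting for \<open>g i\<close> splits \<open>f\<close> into a multiple
    \<open>u * f\<close> and a part \<open>y\<close> in the Jacobian ideal.\<close>
  define u where "u = (\<Sum>i\<in>UNIV. mfps_var i * r i)"
  define y where "y = (\<Sum>i\<in>UNIV. mfps_var i * j i)"
  have "f = y + u * f"
    by (subst (1) g(1)) (simp add: jr(2) u_def y_def distrib_left sum.distrib sum_distrib_right mult.assoc)
  then have *: "(1 - u) * f = y" by (simp add: algebra_simps)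
  have "mfps_var i \<in> (order_ideal 1 :: ('n, 'k) mfps set)" for i
    using mfps_var_power_in_box_ideal[of i 1] by (simp only: order_ideal_1 power_one_right)
  then have "u \<in> order_ideal 1"
    unfolding u_def by (intro ideal_type_ringD(4,6)[OF ideal_order_ideal])
  then obtain v where "(1 - u) * v = 1" by (rule unit_one_minus)
  then have "f = v * y"
    by (simp add: mult.assoc mult.left_commute flip: *) (metis mult.commute mult.left_commute mult_1_right)
  moreover have "y \<in> jacobian_ideal f"
    unfolding y_def by (intro ideal_type_ringD(3,6)[OF ideal_jacobian_ideal] jr(1))
  ultimately show ?thesis
    using ideal_type_ringD(3)[OF ideal_jacobian_ideal] by metis
qed

lemma tjurina_number_eq_milnor_number:
  assumes "f \<in> jacobian_ideal f"
  shows "tjurina_number f = milnor_number f"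
proof -
  have "tjurina_ideal f = jacobian_ideal f"
    unfolding tjurina_ideal_eq
    using ideal_type_ringD(1-3)[OF ideal_jacobian_ideal[of f]] assms
    by (auto intro: exI[of _ 0]) (metis add.right_neutral mult_zero_left)
  then show ?thesis
    by (simp add: tjurina_number_def milnor_number_def)
qed

text \<open>By the Nakayama step some \<open>g\<close> in \<open>order_ideal d\<close> is missing
  from the Tjurina ideal, which itself lies in \<open>order_ideal d\<close> because derivatives lose
  one degree; \<open>quotient_dim_ge\<close> applies.\<close>

lemma tjurina_number_ge_order:
  fixes f :: "('n::finite, 'k::field) mfps"
  assumes f: "f \<in> order_ideal (Suc d)" and "f \<notin> jacobian_ideal f"
  shows "enat (Suc d) \<le> tjurina_number f"
proof -
  have "\<not> order_ideal d \<subseteq> tjurina_ideal f"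
    using mem_jacobian_ideal_if[OF f] assms(2) by blast
  then obtain g where g: "g \<in> order_ideal d" "g \<notin> tjurina_ideal f" by blast
  have "jacobian_ideal f \<subseteq> order_ideal d"
    unfolding jacobian_ideal_def
    by (intro genideal_type_ring(3) ideal_order_ideal) (auto intro: pderiv_order_ideal f)
  moreover have "f \<in> order_ideal d"
    using f order_ideal_antimono[of d "Suc d"] by auto
  ultimately have "tjurina_ideal f \<subseteq> order_ideal d"
    unfolding tjurina_ideal_eq
    using ideal_type_ringD(2,3)[OF ideal_order_ideal[of d]] by blast
  from quotient_dim_ge[OF ideal_tjurina_ideal this g] show ?thesis
    by (simp add: tjurina_number_def)
qed

theorem theorem1p1:
  fixes f :: "('n::finite, 'k::alg_closed_field) mfps"
  assumes "CHAR('k) > 0"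
    and "f \<in> maximal_ideal \<cdot>\<^bsub>mfps_ring\<^esub> maximal_ideal"
    and "tjurina_number f < \<infinity>"
  shows "(milnor_number f < \<infinity> \<longrightarrow>
            fpt f \<ge> 1 / real (the_enat (tjurina_number f)) - 1 / real (the_enat (milnor_number f))) \<and>
         (milnor_number f = \<infinity> \<longrightarrow> fpt f \<ge> 1 / real (the_enat (tjurina_number f)))"
proof -
  have "ideal (maximal_ideal :: ('n, 'k) mfps set) mfps_ring"
    unfolding maximal_ideal_def by (rule genideal_type_ring)
  then have f: "f \<in> maximal_ideal"
    using assms(2) type_ring.ideal_prod_inter by blast
  show ?thesis
  proof (cases "f \<in> jacobian_ideal f")
    case True
    then show ?thesis
      using tjurina_number_eq_milnor_number[OF True] assms(3) fpt_nonneg[OF assms(1) f] by auto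
  next
    case False
    then have "f \<noteq> 0"
      using ideal_type_ringD(1)[OF ideal_jacobian_ideal] by metis
    then obtain a where "mfps_coeff f a \<noteq> 0"
      using mfps_eqI[of f 0] by auto
    then have ex: "f \<notin> order_ideal (Suc (sum a UNIV))"
      by (auto simp: order_ideal_def vanishing_on_def)
    \<comment> \<open>The order of \<open>f\<close>: the least degree of a nonzero
      coefficient.\<close>
    define d where "d = (LEAST d. f \<notin> order_ideal (Suc d))"
    have d: "f \<notin> order_ideal (Suc d)"
      unfolding d_def using ex by (rule LeastI)
    \<comment> \<open>For \<open>d > 0\<close> this is minimality at \<open>d - 1\<close>; for
      \<open>d = 0\<close> it is trivial.\<close>
    have "f \<in> order_ideal d"
      using not_less_Least[of "d - 1" "\<lambda>d. f \<notin> order_ideal (Suc d)"]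
      by (cases d) (simp_all add: d_def[symmetric])
    moreover have "d \<noteq> 0"
      using d f by (metis One_nat_def maximal_ideal_eq order_ideal_1)
    ultimately have "enat d \<le> tjurina_number f"
      using tjurina_number_ge_order[OF _ False, of "d - 1"] by simp
    then have "d \<le> the_enat (tjurina_number f)"
      using assms(3) by (cases "tjurina_number f") auto
    then have "1 / real (the_enat (tjurina_number f)) \<le> 1 / real d"
      using \<open>d \<noteq> 0\<close> by (simp add: frac_le)
    also have "\<dots> \<le> fpt f"
      by (rule fpt_ge_inverse_order[OF assms(1) f d])
    finally have "1 / real (the_enat (tjurina_number f)) \<le> fpt f" .
    \<comment> \<open>Subtracting a nonnegative Milnor term only weakens the bound, so both parts
      follow.\<close>
    moreover have "0 \<le> 1 / real (the_enat (milnor_number f))" by simp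
    ultimately show ?thesis by linarith
  qed
qed

end
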